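(* Fix $n\ge1$ and let $\mathcal Z_n=\{H\in\mathcal H: X_n(H)=0\}$ be the zero set of $X_n$, i.e. the set of $H\in\mathcal H$ satisfying $$H^{(k+n)}-H^{(k)}H^{(n)}+\sum_{l=1}^{k}H^n_lH^{(k-l)}+\sum_{l=1}^{n}H^k_lH^{(n-l)}=0\quad\text{for all }k\ge0.$$ Then (i) every vector field $X_j$, $j\ge1$, is tangent to $\mathcal Z_n$; (ii) at every point of $\mathcal Z_n$ one has $\frac{\partial H^{(n)}}{\partial t_j}=0$ for all $j\ge1$; consequently (iii) the set $\mathcal S_n=\{H\in\mathcal Z_n: H^{(n)}=z^n\}$ is also invariant under all the flows $X_j$.
   Context: Let $z$ be a formal variable and $\mathcal L$ the space of formal Laurent series $\sum_{j\le N} l_j z^j$ (finitely many positive powers of $z$). Let $\mathcal H$ be the set of sequences $H=(H^{(k)})_{k\ge0}$ of elements of $\mathcal L$ with $H^{(0)}=1$ and, for $k\ge1$, $H^{(k)}=z^k+\sum_{l\ge1}H^k_l z^{-l}$; the coefficients $H^k_l$ are coordinates on $\mathcal H$, and we set $H^0_l=0$. The central system (CS) is the family of vector fields $X_j$, $j\ge1$, on $\mathcal H$, with associated times $t_j$, defined by $$\frac{\partial H^{(k)}}{\partial t_j}=H^{(j+k)}-H^{(j)}H^{(k)}+\sum_{l=1}^{k}H^j_lH^{(k-l)}+\sum_{l=1}^{j}H^k_lH^{(j-l)},\qquad k\ge0;$$ the right-hand side contains only negative powers of $z$, so this determines the components $X_j(H^k_l)$. *)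

theory Defs
  imports "HOL-Analysis.Analysis" "HOL-Computational_Algebra.Formal_Laurent_Series"
begin

text \<open>
A point H of the space \<H> is encoded by its coordinates h k l = H^k_l (k,l \<ge> 1), as a function
h :: nat \<Rightarrow> nat \<Rightarrow> complex. Entries with k = 0 or l = 0 are ignored (convention H^0_l = 0).
Laurent series in z with finitely many positive powers are represented as library Laurent
series (finitely many negative powers) in the variable w = z^{-1}; thus the coefficient of
z^m is the coefficient of w^(-m).
\<close>

definition coord :: "(nat \<Rightarrow> nat \<Rightarrow> complex) \<Rightarrow> nat \<Rightarrow> nat \<Rightarrow> complex" where
  "coord h k l = (if k = 0 \<or> l = 0 then 0 else h k l)"

definition Hser :: "(nat \<Rightarrow> nat \<Rightarrow> complex) \<Rightarrow> nat \<Rightarrow> complex fls" where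
  "Hser h k = (if k = 0 then 1
     else fls_X_intpow (- int k) + fps_to_fls (Abs_fps (\<lambda>l. coord h k l)))"

text \<open>Right-hand side of the central system: dH^{(k)}/dt_j.\<close>
definition CSrhs :: "nat \<Rightarrow> nat \<Rightarrow> (nat \<Rightarrow> nat \<Rightarrow> complex) \<Rightarrow> complex fls" where
  "CSrhs j k h = Hser h (j + k) - Hser h j * Hser h k
     + (\<Sum>l = 1..k. fls_const (coord h j l) * Hser h (k - l))
     + (\<Sum>l = 1..j. fls_const (coord h k l) * Hser h (j - l))"

text \<open>Components X_j(H^k_l) of the vector field X_j at h: coefficient of z^{-l} = w^l.\<close>
definition Xfield :: "nat \<Rightarrow> (nat \<Rightarrow> nat \<Rightarrow> complex) \<Rightarrow> nat \<Rightarrow> nat \<Rightarrow> complex" where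
  "Xfield j h k l = (if 1 \<le> k \<and> 1 \<le> l then fls_nth (CSrhs j k h) (int l) else 0)"

definition Zset :: "nat \<Rightarrow> (nat \<Rightarrow> nat \<Rightarrow> complex) set" where
  "Zset n = {h. \<forall>k. CSrhs n k h = 0}"

definition Sset :: "nat \<Rightarrow> (nat \<Rightarrow> nat \<Rightarrow> complex) set" where
  "Sset n = {h \<in> Zset n. Hser h n = fls_X_intpow (- int n)}"

text \<open>Derivative of a (polynomial) function F of the coordinates along the vector field X_j at h:
X_j(F)(h) is the derivative at e = 0 of e \<mapsto> F(h + e X_j(h)).\<close>
definition tangent_at :: "nat \<Rightarrow> ('i \<Rightarrow> (nat \<Rightarrow> nat \<Rightarrow> complex) \<Rightarrow> complex)
     \<Rightarrow> (nat \<Rightarrow> nat \<Rightarrow> complex) \<Rightarrow> bool" where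
  "tangent_at j F h = (\<forall>i. ((\<lambda>e. F i (\<lambda>a b. h a b + e * Xfield j h a b))
                               has_field_derivative 0) (at 0))"

definition Zeqs :: "nat \<Rightarrow> nat \<times> int \<Rightarrow> (nat \<Rightarrow> nat \<Rightarrow> complex) \<Rightarrow> complex" where
  "Zeqs n = (\<lambda>(k, m) h. fls_nth (CSrhs n k h) m)"

definition Seqs :: "nat \<Rightarrow> (nat \<times> int) + int \<Rightarrow> (nat \<Rightarrow> nat \<Rightarrow> complex) \<Rightarrow> complex" where
  "Seqs n = (\<lambda>x h. case x of Inl km \<Rightarrow> Zeqs n km h
                         | Inr m \<Rightarrow> fls_nth (Hser h n - fls_X_intpow (- int n)) m)"

end

theory Submission
  imports Defs
begin

text \<open>
  Let pi(f) = sum_{m >= 0} [z^m]f * H^(m) be the operator replacing each power z^m of a Laurent series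
  by H^(m) and discarding the negative powers. The central system reads
  X_j(H^(k)) = pi(H^(j) H^(k)) - H^(j) H^(k), which is symmetric in j and k; so on Z_n
  we have X_j(H^(n)) = X_n(H^(j)) = 0, which is (ii), and (iii) follows from (i) and (ii).
  For (i), differentiate X_n(H^(k)) = pi(H^(n) H^(k)) - H^(n) H^(k) along X_j. Both the
  argument of pi and pi itself move, the latter by X_j pi(f) = pi(H^(j) pi(f)) - H^(j) pi(f).
  On Z_n the operator pi fixes H^(n) g for every g in its image, and with this the
  derivative cancels.
\<close>

text \<open>
  Laurent series in z are library series in w = z^-1. Thus zdeg_le N f says that f has
  degree at most N in z, and zsubst B E f replaces z^m by E m for m \<le> B; so zsubst B (Hser h)
  is the operator pi on series of degree at most B.
\<close>

definition zdeg_le :: "nat \<Rightarrow> 'a::zero fls \<Rightarrow> bool" where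
  "zdeg_le N f \<longleftrightarrow> (\<forall>i < - int N. fls_nth f i = 0)"

definition zsubst :: "nat \<Rightarrow> (nat \<Rightarrow> 'a::comm_ring_1 fls) \<Rightarrow> 'a fls \<Rightarrow> 'a fls" where
  "zsubst B E f = (\<Sum>m\<le>B. fls_const (fls_nth f (- int m)) * E m)"

lemma zdeg_le_mult:
  fixes f g :: "'a::comm_ring_1 fls"
  assumes "zdeg_le a f" "zdeg_le b g"
  shows "zdeg_le (a + b) (f * g)"
proof (cases "f = 0 \<or> g = 0")
  case False
  have "- int a \<le> fls_subdegree f" "- int b \<le> fls_subdegree g"
    using False assms by (auto intro!: fls_subdegree_geI simp: zdeg_le_def)
  then show ?thesis
    by (auto simp: zdeg_le_def intro!: fls_times_nth_eq0)
qed (auto simp: zdeg_le_def)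

lemma zsubst_add: "zsubst B E (f + g) = zsubst B E f + zsubst B E g"
  by (simp add: zsubst_def distrib_right sum.distrib flip: fls_plus_const)

lemma zsubst_diff: "zsubst B E (f - g) = zsubst B E f - zsubst B E g"
  by (simp add: zsubst_def left_diff_distrib sum_subtractf flip: fls_minus_const)

lemma zsubst_const_mult: "zsubst B E (fls_const c * f) = fls_const c * zsubst B E f"
  by (simp add: zsubst_def sum_distrib_left mult.assoc flip: fls_const_mult_const)

lemma zsubst_sum:
  "finite S \<Longrightarrow> zsubst B E (\<Sum>m\<in>S. fls_const (c m) * G m) = (\<Sum>m\<in>S. fls_const (c m) * zsubst B E (G m))"
  by (induction S rule: finite_induct) (simp_all add: zsubst_add zsubst_const_mult, simp add: zsubst_def)

lemma mult_zsubst: "g * zsubst B E f = (\<Sum>m\<le>B. fls_const (fls_nth f (- int m)) * (g * E m))"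
  by (simp add: zsubst_def sum_distrib_left mult.left_commute)

lemma zsubst_mono: "zdeg_le N f \<Longrightarrow> N \<le> B \<Longrightarrow> zsubst B E f = zsubst N E f"
  unfolding zsubst_def by (rule sum.mono_neutral_right) (auto simp: zdeg_le_def)

lemma fls_nth_Hser:
  "fls_nth (Hser h k) i = (if i = - int k then 1 else 0) + (if i < 0 then 0 else coord h k (nat i))"
  by (auto simp: Hser_def coord_def)

lemma fls_nth_Hser_nonpos: "fls_nth (Hser h k) (- int m) = (if m = k then 1 else 0)"
  by (simp add: fls_nth_Hser coord_def)

lemma zdeg_le_Hser: "zdeg_le k (Hser h k)"
  by (simp add: zdeg_le_def fls_nth_Hser)

lemma fls_nth_zsubst_Hser:
  "fls_nth (zsubst B (Hser h) f) (- int m) = (if m \<le> B then fls_nth f (- int m) else 0)"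
proof -
  have "fls_nth (zsubst B (Hser h) f) (- int m) = (\<Sum>m'\<le>B. if m = m' then fls_nth f (- int m') else 0)"
    unfolding zsubst_def fls_nth_sum by (rule sum.cong) (simp_all add: fls_nth_Hser_nonpos)
  then show ?thesis by simp
qed

lemma Hser_conv_shift: "Hser h k = fls_shift (int k) 1 + fps_to_fls (Abs_fps (coord h k))"
  by (intro fls_eqI) (simp add: fls_nth_Hser coord_def)

lemma fls_nth_Hser_mult_nonpos:
  "fls_nth (Hser h j * Hser h k) (- int m) =
     (if m = j + k then 1 else 0) + (if m < j then coord h k (j - m) else 0)
       + (if m < k then coord h j (k - m) else 0)"
proof -
  let ?A = "Abs_fps (coord h j)" and ?B = "Abs_fps (coord h k)"
  have shift_1: "fls_shift a 1 * f = fls_shift a f" "f * fls_shift a 1 = fls_shift a f"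
    for a and f :: "complex fls"
    using fls_X_intpow_times_conv_shift[where i="-a" and f=f] by simp_all
  have "Hser h j * Hser h k = fls_shift (int j + int k) 1 + fls_shift (int j) (fps_to_fls ?B)
          + fls_shift (int k) (fps_to_fls ?A) + fps_to_fls (?A * ?B)"
    unfolding Hser_conv_shift fls_times_fps_to_fls by (simp add: algebra_simps shift_1)
  moreover have "fls_nth (fps_to_fls (?A * ?B)) (- int m) = 0"
    by (simp add: fps_mult_nth_0 coord_def)
  ultimately show ?thesis
    by (auto simp: coord_def nat_diff_distrib)
qed

lemma sum_coeff_reindex:
  fixes a N :: nat and E :: "nat \<Rightarrow> 'a::comm_ring_1 fls"
  assumes "a \<le> N"
  shows "(\<Sum>m\<le>N. fls_const (if m < a then c (a - m) else 0) * E m) = (\<Sum>l=1..a. fls_const (c l) * E (a - l))"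
proof -
  have "(\<Sum>m\<le>N. fls_const (if m < a then c (a - m) else 0) * E m) = (\<Sum>m<a. fls_const (c (a - m)) * E m)"
    using assms by (intro sum.mono_neutral_cong_right) auto
  also have "\<dots> = (\<Sum>l=1..a. fls_const (c l) * E (a - l))"
    by (rule sum.reindex_bij_witness[where i="\<lambda>l. a - l" and j="\<lambda>m. a - m"]) auto
  finally show ?thesis .
qed

lemma CSrhs_conv_zsubst:
  assumes "j + k \<le> B"
  shows "CSrhs j k h = zsubst B (Hser h) (Hser h j * Hser h k) - Hser h j * Hser h k"
proof -
  let ?P = "Hser h j * Hser h k"
  have "zsubst B (Hser h) ?P = zsubst (j + k) (Hser h) ?P"
    using assms by (intro zsubst_mono zdeg_le_mult zdeg_le_Hser)
  also have "\<dots> = (\<Sum>m\<le>j+k. fls_const (if m = j + k then 1 else 0) * Hser h m)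
       + (\<Sum>m\<le>j+k. fls_const (if m < j then coord h k (j - m) else 0) * Hser h m)
       + (\<Sum>m\<le>j+k. fls_const (if m < k then coord h j (k - m) else 0) * Hser h m)"
    unfolding zsubst_def fls_nth_Hser_mult_nonpos fls_plus_const[symmetric] distrib_right sum.distrib ..
  also have "(\<Sum>m\<le>j+k. fls_const (if m = j + k then 1 else 0) * Hser h m) = Hser h (j + k)"
    by (subst sum.cong[OF refl, where h="\<lambda>m. if m = j + k then Hser h m else 0"]) auto
  also have "(\<Sum>m\<le>j+k. fls_const (if m < j then coord h k (j - m) else 0) * Hser h m)
               = (\<Sum>l=1..j. fls_const (coord h k l) * Hser h (j - l))"
    by (simp add: sum_coeff_reindex)
  also have "(\<Sum>m\<le>j+k. fls_const (if m < k then coord h j (k - m) else 0) * Hser h m)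
               = (\<Sum>l=1..k. fls_const (coord h j l) * Hser h (k - l))"
    by (simp add: sum_coeff_reindex)
  finally show ?thesis
    unfolding CSrhs_def by simp
qed

lemma CSrhs_commute: "CSrhs j k h = CSrhs k j h"
  unfolding CSrhs_def by (simp add: add.commute mult.commute add_ac)

lemma CSrhs_0_right: "CSrhs j 0 h = 0"
  by (simp add: CSrhs_def Hser_def coord_def)

lemma fls_nth_CSrhs_nonpos:
  assumes "i \<le> 0"
  shows "fls_nth (CSrhs j k h) i = 0"
proof -
  obtain m where m: "i = - int m"
    using assms by (metis minus_minus nonneg_int_cases neg_0_le_iff_le)
  have "zdeg_le (j + k) (Hser h j * Hser h k)"
    by (intro zdeg_le_mult zdeg_le_Hser)
  then show ?thesis
    unfolding m CSrhs_conv_zsubst[OF order_refl] by (simp add: fls_nth_zsubst_Hser zdeg_le_def)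
qed

lemma zdeg_le_0_CSrhs: "zdeg_le 0 (CSrhs j k h)"
  by (simp add: zdeg_le_def fls_nth_CSrhs_nonpos)

abbreviation Xstep :: "nat \<Rightarrow> (nat \<Rightarrow> nat \<Rightarrow> complex) \<Rightarrow> complex \<Rightarrow> nat \<Rightarrow> nat \<Rightarrow> complex" where
  "Xstep j h e \<equiv> \<lambda>a b. h a b + e * Xfield j h a b"

lemma Hser_Xstep: "Hser (Xstep j h e) k = Hser h k + fls_const e * CSrhs j k h"
proof (rule fls_eqI)
  fix i
  show "fls_nth (Hser (Xstep j h e) k) i = fls_nth (Hser h k + fls_const e * CSrhs j k h) i"
  proof (cases "i \<le> 0")
    case True
    then show ?thesis by (simp add: fls_nth_Hser fls_nth_CSrhs_nonpos coord_def)
  next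
    case False
    then show ?thesis by (cases "k = 0") (simp_all add: fls_nth_Hser CSrhs_0_right coord_def Xfield_def)
  qed
qed

lemma zsubst_Hser_Xstep:
  "zsubst B (Hser (Xstep j h e)) f = zsubst B (Hser h) f + fls_const e * zsubst B (\<lambda>m. CSrhs j m h) f"
  unfolding zsubst_def Hser_Xstep by (simp add: distrib_left sum.distrib sum_distrib_left mult_ac)

lemma zsubst_CSrhs:
  assumes "j + B \<le> L"
  shows "zsubst B (\<lambda>m. CSrhs j m h) f
           = zsubst L (Hser h) (Hser h j * zsubst B (Hser h) f) - Hser h j * zsubst B (Hser h) f"
proof -
  have "CSrhs j m h = zsubst L (Hser h) (Hser h j * Hser h m) - Hser h j * Hser h m" if "m \<le> B" for m
    using assms that by (intro CSrhs_conv_zsubst) simp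
  then have "zsubst B (\<lambda>m. CSrhs j m h) f
      = (\<Sum>m\<le>B. fls_const (fls_nth f (- int m)) * zsubst L (Hser h) (Hser h j * Hser h m))
        - (\<Sum>m\<le>B. fls_const (fls_nth f (- int m)) * (Hser h j * Hser h m))"
    unfolding zsubst_def[of B "\<lambda>m. CSrhs j m h"] by (simp add: right_diff_distrib sum_subtractf)
  also have "\<dots> = zsubst L (Hser h) (Hser h j * zsubst B (Hser h) f) - Hser h j * zsubst B (Hser h) f"
    by (simp add: mult_zsubst zsubst_sum)
  finally show ?thesis .
qed

lemma zsubst_Hser_mult_fixed:
  assumes zero: "\<And>m. CSrhs n m h = 0" and "n + B \<le> L"
  shows "zsubst L (Hser h) (Hser h n * zsubst B (Hser h) f) = Hser h n * zsubst B (Hser h) f"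
proof -
  have "zsubst L (Hser h) (Hser h n * Hser h m) = Hser h n * Hser h m" if "m \<le> B" for m
    using zero[of m] CSrhs_conv_zsubst[of n m L h] that assms(2) by simp
  then show ?thesis
    by (simp add: mult_zsubst zsubst_sum)
qed

lemma CSrhs_Xstep_expansion:
  fixes h :: "nat \<Rightarrow> nat \<Rightarrow> complex" and n k j :: nat
  defines "P0 \<equiv> Hser h n * Hser h k"
    and "P1 \<equiv> CSrhs j n h * Hser h k + Hser h n * CSrhs j k h"
    and "P2 \<equiv> CSrhs j n h * CSrhs j k h"
    and "\<pi> \<equiv> zsubst (n + k) (Hser h)"
    and "D \<equiv> zsubst (n + k) (\<lambda>m. CSrhs j m h)"
  shows "CSrhs n k (Xstep j h e) =
           (\<pi> P0 - P0) + fls_const e * (D P0 + \<pi> P1 - P1)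
           + fls_const e * (fls_const e * (D P1 + \<pi> P2 - P2))
           + fls_const e * (fls_const e * (fls_const e * D P2))"
proof -
  have "Hser (Xstep j h e) n * Hser (Xstep j h e) k
          = P0 + fls_const e * P1 + fls_const e * (fls_const e * P2)"
    unfolding Hser_Xstep P0_def P1_def P2_def by (simp add: algebra_simps)
  then show ?thesis
    unfolding CSrhs_conv_zsubst[OF order_refl, of n k] zsubst_Hser_Xstep \<pi>_def D_def
    by (simp only: zsubst_add zsubst_const_mult) (simp add: algebra_simps)
qed

lemma CSrhs_Xstep_linear_coeff_eq_0:
  fixes h :: "nat \<Rightarrow> nat \<Rightarrow> complex" and n k j :: nat
  assumes zero: "\<And>m. CSrhs n m h = 0"
  defines "P0 \<equiv> Hser h n * Hser h k"
    and "P1 \<equiv> CSrhs j n h * Hser h k + Hser h n * CSrhs j k h"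
  shows "zsubst (n + k) (\<lambda>m. CSrhs j m h) P0 + zsubst (n + k) (Hser h) P1 - P1 = 0"
proof -
  define L where "L = n + j + k"
  define G where "G = zsubst (j + k) (Hser h) (Hser h j * Hser h k)"
  have P0_fixed: "zsubst (n + k) (Hser h) P0 = P0"
    using zero[of k] CSrhs_conv_zsubst[OF order_refl, of n k h] unfolding P0_def by simp
  have Qn: "CSrhs j n h = 0"
    using zero[of j] by (simp add: CSrhs_commute[of j n])
  have Qk: "CSrhs j k h = G - Hser h j * Hser h k"
    unfolding G_def by (rule CSrhs_conv_zsubst) simp
  have P1: "P1 = Hser h n * G - Hser h j * P0"
    unfolding P1_def P0_def Qn Qk by (simp add: algebra_simps)
  have "zdeg_le n P1"
    using zdeg_le_mult[where a=n and b=0 and f="Hser h n" and g="CSrhs j k h"]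
    unfolding P1_def Qn by (simp add: zdeg_le_Hser zdeg_le_0_CSrhs)
  then have "zsubst (n + k) (Hser h) P1 = zsubst L (Hser h) P1"
    using zsubst_mono[of n P1 "n + k"] zsubst_mono[of n P1 L] by (simp add: L_def)
  also have "\<dots> = Hser h n * G - zsubst L (Hser h) (Hser h j * P0)"
    unfolding P1 zsubst_diff G_def using zero by (simp add: zsubst_Hser_mult_fixed L_def)
  finally have "zsubst (n + k) (Hser h) P1 = Hser h n * G - zsubst L (Hser h) (Hser h j * P0)" .
  moreover have "zsubst (n + k) (\<lambda>m. CSrhs j m h) P0 = zsubst L (Hser h) (Hser h j * P0) - Hser h j * P0"
    using zsubst_CSrhs[of j "n + k" L h P0] by (simp add: P0_fixed L_def)
  ultimately show ?thesis
    by (simp add: P1)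
qed

lemma has_field_derivative_fls_nth_cubic:
  "((\<lambda>e. fls_nth (c0 + fls_const e * c1 + fls_const e * (fls_const e * c2)
                    + fls_const e * (fls_const e * (fls_const e * c3))) m)
     has_field_derivative fls_nth c1 m) (at 0)"
  by (auto intro!: derivative_eq_intros)

lemma Zeqs_apply: "Zeqs n (k, m) h = fls_nth (CSrhs n k h) m"
  by (simp add: Zeqs_def)

lemma tangent_at_Zeqs:
  assumes "h \<in> Zset n"
  shows "tangent_at j (Zeqs n) h"
  unfolding tangent_at_def
proof (intro allI, clarify)
  fix k m
  have zero: "\<And>m. CSrhs n m h = 0"
    using assms by (simp add: Zset_def)
  have "((\<lambda>e. Zeqs n (k, m) (Xstep j h e)) has_field_derivative fls_nth 0 m) (at 0)"
    unfolding Zeqs_apply CSrhs_Xstep_expansion CSrhs_Xstep_linear_coeff_eq_0[OF zero]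
    by (rule has_field_derivative_fls_nth_cubic)
  then show "((\<lambda>e. Zeqs n (k, m) (Xstep j h e)) has_field_derivative 0) (at 0)"
    by simp
qed

lemma CSrhs_eq_0_if_Zset: "h \<in> Zset n \<Longrightarrow> CSrhs j n h = 0"
  by (simp add: Zset_def CSrhs_commute[of j n])

lemma tangent_at_Seqs:
  assumes "h \<in> Sset n"
  shows "tangent_at j (Seqs n) h"
  unfolding tangent_at_def
proof
  fix x
  have Z: "h \<in> Zset n"
    using assms by (simp add: Sset_def)
  show "((\<lambda>e. Seqs n x (Xstep j h e)) has_field_derivative 0) (at 0)"
  proof (cases x)
    case (Inl km)
    then show ?thesis
      using tangent_at_Zeqs[OF Z, of j] by (cases km) (simp add: Seqs_def tangent_at_def)
  next
    case (Inr m)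
    then show ?thesis
      by (simp add: Seqs_def Hser_Xstep CSrhs_eq_0_if_Zset[OF Z])
  qed
qed

theorem mainTheorem5:
  fixes n :: nat
  assumes "1 \<le> n"
  shows "(\<forall>h \<in> Zset n. \<forall>j \<ge> 1. tangent_at j (Zeqs n) h)
       \<and> (\<forall>h \<in> Zset n. \<forall>j \<ge> 1. CSrhs j n h = 0)
       \<and> (\<forall>h \<in> Sset n. \<forall>j \<ge> 1. tangent_at j (Seqs n) h)"
  using tangent_at_Zeqs CSrhs_eq_0_if_Zset tangent_at_Seqs by blast

end
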